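(* The vectors $\hat C_i^{-},\hat C_i^{+}$ $(0\le i\le d-1)$ form an orthogonal basis for $\mathbf W=\mathrm{Span}\{\hat C_i^{-},\hat C_i^{+}:0\le i\le d-1\}$. Moreover, for $0\le i\le d-1$, $$\|\hat C_i^-\|^2=\frac{\tilde b_0\tilde b_1\cdots\tilde b_{i-1}}{c_1c_2\cdots c_i},\qquad \|\hat C_i^+\|^2=\frac{b_1b_2\cdots b_i}{\tilde c_1\tilde c_2\cdots\tilde c_i}\,(|C|-1).$$
   Context: **Graph.** $\Gamma$ is a finite undirected connected graph without loops or multiple edges, with vertex set $X$, path-length distance $\partial$ and diameter $d\ge 3$; $\Gamma_i(y)=\{z\in X:\partial(y,z)=i\}$, $\Gamma(y)=\Gamma_1(y)$. $\Gamma$ is distance-regular: $p^h_{ij}=|\Gamma_i(y)\cap\Gamma_j(z)|$ depends only on $i,j$ and $h=\partial(y,z)$. Put $a_i=p^i_{1,i}$, $b_i=p^i_{1,i+1}$, $c_i=p^i_{1,i-1}$ ($b_d=c_0=0$), $k=b_0$. Complex matrices indexed by $X$ act on $\mathbf V=\mathbb C^X$ with inner product $\langle u,v\rangle=u^t\overline v$ and $\|u\|^2=\langle u,u\rangle$; $\hat y$ is the standard basis vector at $y$, $\hat Y=\sum_{y\in Y}\hat y$. $A_i$ is the $i$-th distance matrix, $A=A_1$, $\mathcal M$ is the algebra generated by $A$ (Bose–Mesner algebra), with primitive idempotents $E_0=|X|^{-1}J,E_1,\dots,E_d$ ($J$ all-ones) and $A=\sum_i\theta_iE_i$. $\Gamma$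 is $Q$-polynomial with respect to $E_0,\dots,E_d$: writing $E_i\circ E_j=|X|^{-1}\sum_h q^h_{ij}E_h$ (entrywise product), $q^h_{ij}=0$ (resp. $\ne0$) if one of $h,i,j$ is greater than (resp. equal to) the sum of the other two. It is assumed that $\theta_0>\theta_1>\dots>\theta_d$. **Clique.** $C\subseteq X$ is a Delsarte clique: a nonempty set of mutually adjacent vertices with $|C|=1-k/\theta_d$. Fix $x\in C$. $A^*=A^*(x)$ is the diagonal matrix with $(z,z)$-entry $|X|(E_1)_{xz}$; $E^*_i$ ($0\le i\le d$) is the diagonal projection onto $\mathrm{Span}\{\hat z:\partial(x,z)=i\}$, and $A^*=\sum_i\theta^*_iE^*_i$. For $0\le i\le d-1$, $C_i=\{y\in X:\partial(y,C)=i\}$ (these partition $X$); $C_i^-=C_i\cap\Gamma_i(x)$, $C_i^+=C_i\cap\Gamma_{i+1}(x)$. For $z\in C_i$ the numbers $\tilde b_i=|\Gamma(z)\cap C_{i+1}|$ ($0\le i\le d-2$) and $\tilde c_i=|\Gamma(z)\cap C_{i-1}|$ ($1\le i\le d-1$) do not depend on the choice of $z\in C_i$ and are nonzero. Empty products equal $1$. **Leonard systems.** On a complex vector space $V$ of dimension $n+1$, a Leonard system of diameter $n$ is a sequence $(B;B^*;\{F_i\}_{i=0}^n;\{F^*_i\}_{i=0}^n)$ where $B,B^*\in\mathrm{End}(V)$ each have $n+1$ distinct eigenvalues, $\{F_i\}$ (resp. $\{F_i^*\}$) is an ordering of the primitive idempotents (spectral projections) of $B$ (resp. $B^*$), and $F_iB^*F_j$,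 $F^*_iBF^*_j$ are $0$ if $|i-j|>1$ and nonzero if $|i-j|=1$. Eigenvalues $\vartheta_i$, dual eigenvalues $\vartheta^*_i$ are defined by $BF_i=\vartheta_iF_i$, $B^*F_i^*=\vartheta_i^*F_i^*$. The first split sequence is the sequence of nonzero scalars $\varphi_1,\dots,\varphi_n$ such that in some basis $B$ is lower bidiagonal with diagonal $\vartheta_0,\dots,\vartheta_n$ and subdiagonal entries $1$, and $B^*$ is upper bidiagonal with diagonal $\vartheta^*_0,\dots,\vartheta_n^*$ and superdiagonal $\varphi_1,\dots,\varphi_n$. The second split sequence $\{\phi_i\}$ is the first split sequence of $(B;B^*;\{F_{n-i}\};\{F^*_i\})$. The parameter array is $(\{\vartheta_i\},\{\vartheta_i^*\},\{\varphi_i\},\{\phi_i\})$. **$q$-Racah assumption.** $q\in\mathbb C$ is nonzero, $q^2\neq1$. $(A;A^*;\{E_i\}_{i=0}^d;\{E_i^*\}_{i=0}^d)$ acts on $\mathcal M\hat x$ (of dimension $d+1$) as a Leonard system $\Phi$ with parameter array $(\{\theta_i\},\{\theta^*_i\},\{\varphi_i\},\{\phi_i\})$. $\Gamma$ is assumed to have $q$-Racah type: there are nonzero $h,h^*,s,s^*,r_1,r_2\in\mathbb C$ (fixed) with $r_1r_2=ss^*q^{d+1}$, none of $q^i,r_1q^i,r_2q^i,s^*q^i/r_1,s^*q^i/r_2$ equal to $1$ for $1\le i\le d$, neither of $sq^i,s^*q^i$ equal to $1$ for $2\le i\le 2d$, and $\theta_i=\theta_0+h(1-q^i)(1-sq^{i+1})q^{-i}$,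 $\theta^*_i=\theta^*_0+h^*(1-q^i)(1-s^*q^{i+1})q^{-i}$ ($0\le i\le d$), $\varphi_i=hh^*q^{1-2i}(1-q^i)(1-q^{i-d-1})(1-r_1q^i)(1-r_2q^i)$, $\phi_i=hh^*q^{1-2i}(1-q^i)(1-q^{i-d-1})(r_1-s^*q^i)(r_2-s^*q^i)/s^*$ ($1\le i\le d$). *)

theory Defs
  imports "HOL-Analysis.Analysis"
begin

section \<open>Distance-regular graphs\<close>

text \<open>
  The vertex set is a finite type and the graph is its adjacency relation, so that complex
  matrices indexed by the vertices have type \<^typ>\<open>complex ^ 'a ^ 'a\<close>.
\<close>

definition simple_graph :: "('a::finite \<Rightarrow> 'a \<Rightarrow> bool) \<Rightarrow> bool" where
  "simple_graph adj \<longleftrightarrow> symp adj \<and> irreflp adj"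

definition connected_graph :: "('a::finite \<Rightarrow> 'a \<Rightarrow> bool) \<Rightarrow> bool" where
  "connected_graph adj \<longleftrightarrow> (\<forall>y z. adj\<^sup>*\<^sup>* y z)"

definition gdist :: "('a::finite \<Rightarrow> 'a \<Rightarrow> bool) \<Rightarrow> 'a \<Rightarrow> 'a \<Rightarrow> nat" where
  "gdist adj y z = (LEAST n. (adj ^^ n) y z)"

definition gdiameter :: "('a::finite \<Rightarrow> 'a \<Rightarrow> bool) \<Rightarrow> nat" where
  "gdiameter adj = Max {gdist adj y z | y z. True}"

definition sphere_at :: "('a::finite \<Rightarrow> 'a \<Rightarrow> bool) \<Rightarrow> nat \<Rightarrow> 'a \<Rightarrow> 'a set" where
  "sphere_at adj i y = {z. gdist adj y z = i}"

definition distance_regular :: "('a::finite \<Rightarrow> 'a \<Rightarrow> bool) \<Rightarrow> bool" where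
  "distance_regular adj \<longleftrightarrow>
     (\<forall>i j y z y' z'. gdist adj y z = gdist adj y' z' \<longrightarrow>
        card (sphere_at adj i y \<inter> sphere_at adj j z) =
        card (sphere_at adj i y' \<inter> sphere_at adj j z'))"

text \<open>
  The number \<open>p\<^sup>h\<^sub>i\<^sub>j\<close>, as the common value over all pairs at distance \<open>h\<close>; meaningful for
  \<open>h\<close> at most the diameter of a distance-regular graph.
\<close>

definition intersection_number :: "('a::finite \<Rightarrow> 'a \<Rightarrow> bool) \<Rightarrow> nat \<Rightarrow> nat \<Rightarrow> nat \<Rightarrow> nat" where
  "intersection_number adj h i j =
     (THE n. \<forall>y z. gdist adj y z = h \<longrightarrow>
        card (sphere_at adj i y \<inter> sphere_at adj j z) = n)"

definition b_num :: "('a::finite \<Rightarrow> 'a \<Rightarrow> bool) \<Rightarrow> nat \<Rightarrow> nat" where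
  "b_num adj i = intersection_number adj i 1 (i + 1)"

definition c_num :: "('a::finite \<Rightarrow> 'a \<Rightarrow> bool) \<Rightarrow> nat \<Rightarrow> nat" where
  "c_num adj i = (if i = 0 then 0 else intersection_number adj i 1 (i - 1))"

definition valency :: "('a::finite \<Rightarrow> 'a \<Rightarrow> bool) \<Rightarrow> nat" where
  "valency adj = b_num adj 0"


section \<open>The Bose-Mesner algebra and the Q-polynomial property\<close>

definition mscale :: "complex \<Rightarrow> complex ^ 'a ^ 'a \<Rightarrow> complex ^ 'a ^ 'a" where
  "mscale c M = (\<chi> y z. c * M $ y $ z)"

definition adj_matrix :: "('a::finite \<Rightarrow> 'a \<Rightarrow> bool) \<Rightarrow> complex ^ 'a ^ 'a" where
  "adj_matrix adj = (\<chi> y z. if adj y z then 1 else 0)"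

inductive_set bose_mesner :: "('a::finite \<Rightarrow> 'a \<Rightarrow> bool) \<Rightarrow> (complex ^ 'a ^ 'a) set"
  for adj :: "'a \<Rightarrow> 'a \<Rightarrow> bool" where
  one: "mat 1 \<in> bose_mesner adj"
| gen: "adj_matrix adj \<in> bose_mesner adj"
| add: "M \<in> bose_mesner adj \<Longrightarrow> N \<in> bose_mesner adj \<Longrightarrow> M + N \<in> bose_mesner adj"
| scale: "M \<in> bose_mesner adj \<Longrightarrow> mscale c M \<in> bose_mesner adj"
| mult: "M \<in> bose_mesner adj \<Longrightarrow> N \<in> bose_mesner adj \<Longrightarrow> M ** N \<in> bose_mesner adj"

definition primitive_idempotent :: "(complex ^ 'a ^ 'a) set \<Rightarrow> complex ^ 'a ^ 'a \<Rightarrow> bool" where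
  "primitive_idempotent S e \<longleftrightarrow>
     e \<in> S \<and> e \<noteq> 0 \<and> e ** e = e \<and>
     (\<forall>f\<in>S. f ** f = f \<and> e ** f = f \<and> f ** e = f \<longrightarrow> f = 0 \<or> f = e)"

definition primitive_idempotents_of ::
    "('a::finite \<Rightarrow> 'a \<Rightarrow> bool) \<Rightarrow> nat \<Rightarrow> (nat \<Rightarrow> complex ^ 'a ^ 'a) \<Rightarrow> bool" where
  "primitive_idempotents_of adj d E \<longleftrightarrow>
     bij_betw E {0..d} {e. primitive_idempotent (bose_mesner adj) e} \<and>
     E 0 = (\<chi> y z. 1 / of_nat CARD('a))"

definition Q_polynomial :: "nat \<Rightarrow> (nat \<Rightarrow> complex ^ 'a ^ 'a) \<Rightarrow> bool" where
  "Q_polynomial d E \<longleftrightarrow>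
     (\<exists>krein :: nat \<Rightarrow> nat \<Rightarrow> nat \<Rightarrow> complex.
        (\<forall>i\<le>d. \<forall>j\<le>d. \<forall>y z.
           E i $ y $ z * E j $ y $ z =
             1 / of_nat CARD('a) * (\<Sum>h=0..d. krein h i j * E h $ y $ z)) \<and>
        (\<forall>h\<le>d. \<forall>i\<le>d. \<forall>j\<le>d.
           (h > i + j \<or> i > h + j \<or> j > h + i \<longrightarrow> krein h i j = 0) \<and>
           (h = i + j \<or> i = h + j \<or> j = h + i \<longrightarrow> krein h i j \<noteq> 0)))"

text \<open>\<open>A\<^sup>*(x)\<close>, \<open>E\<^sup>*\<^sub>i(x)\<close> and the primary module \<open>\<M> x\<close>.\<close>

definition dual_adj_matrix :: "(nat \<Rightarrow> complex ^ 'a ^ 'a) \<Rightarrow> 'a \<Rightarrow> complex ^ 'a ^ 'a" where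
  "dual_adj_matrix E x = (\<chi> y z. if y = z then of_nat CARD('a) * E 1 $ x $ z else 0)"

definition dual_idempotent :: "('a::finite \<Rightarrow> 'a \<Rightarrow> bool) \<Rightarrow> 'a \<Rightarrow> nat \<Rightarrow> complex ^ 'a ^ 'a" where
  "dual_idempotent adj x i = (\<chi> y z. if y = z \<and> gdist adj x z = i then 1 else 0)"

definition hat :: "'a::finite set \<Rightarrow> complex ^ 'a" where
  "hat Y = (\<Sum>y\<in>Y. axis y 1)"

definition primary_module :: "('a::finite \<Rightarrow> 'a \<Rightarrow> bool) \<Rightarrow> 'a \<Rightarrow> (complex ^ 'a) set" where
  "primary_module adj x = {M *v axis x 1 | M. M \<in> bose_mesner adj}"


section \<open>Delsarte cliques\<close>

text \<open>The argument \<open>t\<close> is the least eigenvalue of the adjacency matrix.\<close>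

definition Delsarte_clique :: "('a::finite \<Rightarrow> 'a \<Rightarrow> bool) \<Rightarrow> real \<Rightarrow> 'a set \<Rightarrow> bool" where
  "Delsarte_clique adj t C \<longleftrightarrow>
     C \<noteq> {} \<and> (\<forall>y\<in>C. \<forall>z\<in>C. y \<noteq> z \<longrightarrow> adj y z) \<and>
     real (card C) = 1 - real (valency adj) / t"

definition dist_set :: "('a::finite \<Rightarrow> 'a \<Rightarrow> bool) \<Rightarrow> 'a \<Rightarrow> 'a set \<Rightarrow> nat" where
  "dist_set adj y C = Min (gdist adj y ` C)"

definition clique_cell :: "('a::finite \<Rightarrow> 'a \<Rightarrow> bool) \<Rightarrow> 'a set \<Rightarrow> nat \<Rightarrow> 'a set" where
  "clique_cell adj C i = {y. dist_set adj y C = i}"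

definition clique_minus :: "('a::finite \<Rightarrow> 'a \<Rightarrow> bool) \<Rightarrow> 'a set \<Rightarrow> 'a \<Rightarrow> nat \<Rightarrow> 'a set" where
  "clique_minus adj C x i = clique_cell adj C i \<inter> sphere_at adj i x"

definition clique_plus :: "('a::finite \<Rightarrow> 'a \<Rightarrow> bool) \<Rightarrow> 'a set \<Rightarrow> 'a \<Rightarrow> nat \<Rightarrow> 'a set" where
  "clique_plus adj C x i = clique_cell adj C i \<inter> sphere_at adj (i + 1) x"

text \<open>
  The numbers \<open>b~\<^sub>i\<close> and \<open>c~\<^sub>i\<close> are again common values: for a Delsarte clique in a
  distance-regular graph of diameter \<open>d\<close> the cardinalities do not depend on \<open>z\<close>, for
  \<open>0 \<le> i \<le> d - 2\<close> and \<open>1 \<le> i \<le> d - 1\<close>, respectively.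
\<close>

definition b_tilde :: "('a::finite \<Rightarrow> 'a \<Rightarrow> bool) \<Rightarrow> 'a set \<Rightarrow> nat \<Rightarrow> nat" where
  "b_tilde adj C i =
     (THE n. \<forall>z\<in>clique_cell adj C i.
        card (sphere_at adj 1 z \<inter> clique_cell adj C (i + 1)) = n)"

definition c_tilde :: "('a::finite \<Rightarrow> 'a \<Rightarrow> bool) \<Rightarrow> 'a set \<Rightarrow> nat \<Rightarrow> nat" where
  "c_tilde adj C i =
     (THE n. \<forall>z\<in>clique_cell adj C i.
        card (sphere_at adj 1 z \<inter> clique_cell adj C (i - 1)) = n)"


section \<open>Leonard systems\<close>

text \<open>
  Endomorphisms of a subspace \<open>V\<close> are given by matrices that leave \<open>V\<close> invariant; all
  conditions concern their restrictions to \<open>V\<close> only.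
\<close>

definition acts_on :: "(complex ^ 'a) set \<Rightarrow> complex ^ 'a ^ 'a \<Rightarrow> bool" where
  "acts_on V B \<longleftrightarrow> (\<forall>v\<in>V. B *v v \<in> V)"

definition eigenvalues_on :: "(complex ^ 'a) set \<Rightarrow> complex ^ 'a ^ 'a \<Rightarrow> complex set" where
  "eigenvalues_on V B = {t. \<exists>v\<in>V. v \<noteq> 0 \<and> B *v v = t *s v}"

text \<open>
  \<open>F\<close> restricted to \<open>V\<close> is the projection onto the \<open>t\<close>-eigenspace of \<open>B\<close> along the
  other eigenspaces (which together span \<open>V\<close> when \<open>B\<close> is diagonalizable on \<open>V\<close>).
\<close>

definition spectral_projection_on ::
    "(complex ^ 'a) set \<Rightarrow> complex ^ 'a ^ 'a \<Rightarrow> complex \<Rightarrow> complex ^ 'a ^ 'a \<Rightarrow> bool" where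
  "spectral_projection_on V B t F \<longleftrightarrow>
     (\<forall>s\<in>eigenvalues_on V B. \<forall>v\<in>V. B *v v = s *s v \<longrightarrow> F *v v = (if s = t then v else 0))"

definition spectral_ordering_on ::
    "(complex ^ 'a) set \<Rightarrow> nat \<Rightarrow> complex ^ 'a ^ 'a \<Rightarrow> (nat \<Rightarrow> complex ^ 'a ^ 'a) \<Rightarrow> bool" where
  "spectral_ordering_on V n B F \<longleftrightarrow>
     (\<exists>t. bij_betw t {0..n} (eigenvalues_on V B) \<and>
          (\<forall>i\<le>n. spectral_projection_on V B (t i) (F i)))"

definition tridiagonal_on ::
    "(complex ^ 'a) set \<Rightarrow> nat \<Rightarrow> complex ^ 'a ^ 'a \<Rightarrow> (nat \<Rightarrow> complex ^ 'a ^ 'a) \<Rightarrow> bool" where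
  "tridiagonal_on V n B F \<longleftrightarrow>
     (\<forall>i\<le>n. \<forall>j\<le>n.
        (\<bar>int i - int j\<bar> > 1 \<longrightarrow> (\<forall>v\<in>V. (F i ** B ** F j) *v v = 0)) \<and>
        (\<bar>int i - int j\<bar> = 1 \<longrightarrow> (\<exists>v\<in>V. (F i ** B ** F j) *v v \<noteq> 0)))"

definition Leonard_system ::
    "(complex ^ 'a) set \<Rightarrow> nat \<Rightarrow> complex ^ 'a ^ 'a \<Rightarrow> complex ^ 'a ^ 'a \<Rightarrow>
     (nat \<Rightarrow> complex ^ 'a ^ 'a) \<Rightarrow> (nat \<Rightarrow> complex ^ 'a ^ 'a) \<Rightarrow> bool" where
  "Leonard_system V n B Bs F Fs \<longleftrightarrow>
     vec.subspace V \<and> vec.dim V = n + 1 \<and> acts_on V B \<and> acts_on V Bs \<and>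
     card (eigenvalues_on V B) = n + 1 \<and> card (eigenvalues_on V Bs) = n + 1 \<and>
     spectral_ordering_on V n B F \<and> spectral_ordering_on V n Bs Fs \<and>
     tridiagonal_on V n Bs F \<and> tridiagonal_on V n B Fs"

definition eigenvalue_seq ::
    "(complex ^ 'a) set \<Rightarrow> nat \<Rightarrow> complex ^ 'a ^ 'a \<Rightarrow> (nat \<Rightarrow> complex ^ 'a ^ 'a) \<Rightarrow>
     (nat \<Rightarrow> complex) \<Rightarrow> bool" where
  "eigenvalue_seq V n B F t \<longleftrightarrow> (\<forall>i\<le>n. \<forall>v\<in>V. (B ** F i) *v v = t i *s (F i *v v))"

text \<open>
  Matrices represent endomorphisms by columns: with respect to \<open>u\<^sub>0, \<dots>, u\<^sub>n\<close>, the lower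
  bidiagonal shape of \<open>B\<close> reads \<open>B u\<^sub>i = t\<^sub>i u\<^sub>i + u\<^sub>i\<^sub>+\<^sub>1\<close> and the upper bidiagonal shape of
  \<open>B\<^sup>*\<close> reads \<open>B\<^sup>* u\<^sub>i = t\<^sup>*\<^sub>i u\<^sub>i + \<phi>\<^sub>i u\<^sub>i\<^sub>-\<^sub>1\<close>.
\<close>

definition first_split_seq ::
    "(complex ^ 'a) set \<Rightarrow> nat \<Rightarrow> complex ^ 'a ^ 'a \<Rightarrow> complex ^ 'a ^ 'a \<Rightarrow>
     (nat \<Rightarrow> complex ^ 'a ^ 'a) \<Rightarrow> (nat \<Rightarrow> complex ^ 'a ^ 'a) \<Rightarrow> (nat \<Rightarrow> complex) \<Rightarrow> bool" where
  "first_split_seq V n B Bs F Fs \<phi> \<longleftrightarrow>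
     (\<forall>i\<in>{1..n}. \<phi> i \<noteq> 0) \<and>
     (\<exists>t ts u. eigenvalue_seq V n B F t \<and> eigenvalue_seq V n Bs Fs ts \<and>
        inj_on u {0..n} \<and> vec.independent (u ` {0..n}) \<and> vec.span (u ` {0..n}) = V \<and>
        (\<forall>i\<le>n. B *v u i = t i *s u i + (if i < n then u (i + 1) else 0)) \<and>
        (\<forall>i\<le>n. Bs *v u i = ts i *s u i + (if 0 < i then \<phi> i *s u (i - 1) else 0)))"

definition parameter_array ::
    "(complex ^ 'a) set \<Rightarrow> nat \<Rightarrow> complex ^ 'a ^ 'a \<Rightarrow> complex ^ 'a ^ 'a \<Rightarrow>
     (nat \<Rightarrow> complex ^ 'a ^ 'a) \<Rightarrow> (nat \<Rightarrow> complex ^ 'a ^ 'a) \<Rightarrow>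
     (nat \<Rightarrow> complex) \<Rightarrow> (nat \<Rightarrow> complex) \<Rightarrow> (nat \<Rightarrow> complex) \<Rightarrow> (nat \<Rightarrow> complex) \<Rightarrow> bool" where
  "parameter_array V n B Bs F Fs t ts \<phi>\<^sub>1 \<phi>\<^sub>2 \<longleftrightarrow>
     eigenvalue_seq V n B F t \<and> eigenvalue_seq V n Bs Fs ts \<and>
     first_split_seq V n B Bs F Fs \<phi>\<^sub>1 \<and>
     first_split_seq V n B Bs (\<lambda>i. F (n - i)) Fs \<phi>\<^sub>2"

definition q_Racah ::
    "complex \<Rightarrow> nat \<Rightarrow> complex \<Rightarrow> complex \<Rightarrow> complex \<Rightarrow> complex \<Rightarrow> complex \<Rightarrow> complex \<Rightarrow>
     (nat \<Rightarrow> complex) \<Rightarrow> (nat \<Rightarrow> complex) \<Rightarrow> (nat \<Rightarrow> complex) \<Rightarrow> (nat \<Rightarrow> complex) \<Rightarrow> bool" where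
  "q_Racah q d h hs s ss r\<^sub>1 r\<^sub>2 t ts \<phi>\<^sub>1 \<phi>\<^sub>2 \<longleftrightarrow>
     q \<noteq> 0 \<and> q\<^sup>2 \<noteq> 1 \<and>
     h \<noteq> 0 \<and> hs \<noteq> 0 \<and> s \<noteq> 0 \<and> ss \<noteq> 0 \<and> r\<^sub>1 \<noteq> 0 \<and> r\<^sub>2 \<noteq> 0 \<and>
     r\<^sub>1 * r\<^sub>2 = s * ss * q ^ (d + 1) \<and>
     (\<forall>i\<in>{1..d}. q ^ i \<noteq> 1 \<and> r\<^sub>1 * q ^ i \<noteq> 1 \<and> r\<^sub>2 * q ^ i \<noteq> 1 \<and>
        ss * q ^ i / r\<^sub>1 \<noteq> 1 \<and> ss * q ^ i / r\<^sub>2 \<noteq> 1) \<and>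
     (\<forall>i\<in>{2..2 * d}. s * q ^ i \<noteq> 1 \<and> ss * q ^ i \<noteq> 1) \<and>
     (\<forall>i\<le>d. t i = t 0 + h * (1 - q ^ i) * (1 - s * q ^ (i + 1)) * q powi (- int i)) \<and>
     (\<forall>i\<le>d. ts i = ts 0 + hs * (1 - q ^ i) * (1 - ss * q ^ (i + 1)) * q powi (- int i)) \<and>
     (\<forall>i\<in>{1..d}. \<phi>\<^sub>1 i =
        h * hs * q powi (1 - 2 * int i) * (1 - q ^ i) * (1 - q powi (int i - int d - 1)) *
        (1 - r\<^sub>1 * q ^ i) * (1 - r\<^sub>2 * q ^ i)) \<and>
     (\<forall>i\<in>{1..d}. \<phi>\<^sub>2 i =
        h * hs * q powi (1 - 2 * int i) * (1 - q ^ i) * (1 - q powi (int i - int d - 1)) *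
        (r\<^sub>1 - ss * q ^ i) * (r\<^sub>2 - ss * q ^ i) / ss)"


section \<open>Hermitian inner product\<close>

definition hinner :: "complex ^ 'a \<Rightarrow> complex ^ 'a \<Rightarrow> complex" where
  "hinner u v = (\<Sum>y\<in>UNIV. u $ y * cnj (v $ y))"

lemma hinner_self: "hinner u u = complex_of_real ((norm u)\<^sup>2)"
  by (simp add: hinner_def norm_vec_def L2_set_def sum_nonneg complex_norm_square
      del: of_real_power)

text \<open>
  \<open>f\<close> is a family indexed by \<open>I\<close>; injectivity makes linear independence of its range
  that of the family.
\<close>

definition orthogonal_basis :: "'i set \<Rightarrow> ('i \<Rightarrow> complex ^ 'a) \<Rightarrow> (complex ^ 'a) set \<Rightarrow> bool" where
  "orthogonal_basis I f W \<longleftrightarrow>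
     inj_on f I \<and> vec.independent (f ` I) \<and> vec.span (f ` I) = W \<and>
     (\<forall>i\<in>I. \<forall>j\<in>I. i \<noteq> j \<longrightarrow> hinner (f i) (f j) = 0)"

end

theory Submission
  imports Defs
begin

text \<open>
  The norms are cardinalities, since \<open>\<parallel>hat Y\<parallel>\<^sup>2 = |Y|\<close>, and orthogonality is the disjointness
  of the sets \<open>C\<^sub>i\<^sup>-\<close> and \<open>C\<^sub>i\<^sup>+\<close>. What remains is to see that these sets are nonempty and to
  count them; the cardinalities come from counting, in two ways, the edges between \<open>C\<^sub>i\<^sup>-\<close>
  and \<open>C\<^sub>i\<^sub>+\<^sub>1\<^sup>-\<close>, and between \<open>C\<^sub>i\<^sup>+\<close> and \<open>C\<^sub>i\<^sub>+\<^sub>1\<^sup>+\<close> (\<open>card_minus_step\<close>, \<open>card_plus_step\<close>).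

  This needs that \<open>b~\<^sub>i\<close> and \<open>c~\<^sub>i\<close> are well defined and nonzero, which is where the Delsarte
  property enters. The entries of \<open>E\<^sub>d\<close> are real numbers \<open>f(\<partial>(y, z))\<close> with \<open>f(0) > 0\<close>
  (\<open>idempotent_real_entries\<close>), and \<open>\<theta>\<^sub>d < 0\<close> because the adjacency matrix has trace zero.
  If \<open>u\<close> is the characteristic vector of the clique, then its size makes
  \<open>\<parallel>E\<^sub>d u\<parallel>\<^sup>2 = u\<^sup>t E\<^sub>d u\<close> vanish (\<open>Delsarte_clique_kernel\<close>). Now let \<open>y\<close> be at distance \<open>i\<close>
  from the clique and let \<open>N\<close> of its members be at distance \<open>i\<close> from \<open>y\<close>; the others are at
  distance \<open>i + 1\<close>, so the entry of \<open>E\<^sub>d u\<close> at \<open>y\<close> gives \<open>N f(i) + (|C| - N) f(i + 1) = 0\<close>. As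
  \<open>f\<close> has no two consecutive zeros (\<open>no_consecutive_zeros\<close>), this determines
  \<open>N = N\<^sub>i\<close> (\<open>near_eq\<close>). Double counting then gives \<open>c~\<^sub>i N\<^sub>i\<^sub>-\<^sub>1 = N\<^sub>i c\<^sub>i\<close> and
  \<open>b~\<^sub>i (|C| - N\<^sub>i\<^sub>+\<^sub>1) = (|C| - N\<^sub>i) b\<^sub>i\<^sub>+\<^sub>1\<close> (\<open>c_tilde_balance\<close>, \<open>b_tilde_balance\<close>), where
  \<open>0 < N\<^sub>i < |C|\<close> for \<open>0 \<le> i \<le> d - 1\<close>.
\<close>


section \<open>Distances\<close>

text \<open>A finite connected graph without loops or multiple edges.\<close>

locale connected_simple_graph =
  fixes adj :: "'a::finite \<Rightarrow> 'a \<Rightarrow> bool"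
  assumes simple: "simple_graph adj" and conn: "connected_graph adj"
begin

lemma adj_sym: "adj y z \<Longrightarrow> adj z y"
  using simple unfolding simple_graph_def by (auto dest: sympD)

lemma adj_irrefl: "\<not> adj y y"
  using simple unfolding simple_graph_def by (auto dest: irreflpD)

lemma gdist_walk: "(adj ^^ gdist adj y z) y z"
proof -
  have "adj\<^sup>*\<^sup>* y z" using conn unfolding connected_graph_def by blast
  then obtain n where "(adj ^^ n) y z" using rtranclp_imp_relpowp by metis
  then show ?thesis unfolding gdist_def by (rule LeastI)
qed

lemma gdist_le: "(adj ^^ n) y z \<Longrightarrow> gdist adj y z \<le> n"
  unfolding gdist_def by (rule Least_le)

lemma walk_rev: "(adj ^^ n) y z \<Longrightarrow> (adj ^^ n) z y"
proof (induction n arbitrary: z)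
  case (Suc n)
  then obtain w where "(adj ^^ n) y w" "adj w z" by auto
  then show ?case using Suc.IH[of w] adj_sym[of w z] relpowp_Suc_I2 by metis
qed simp

lemma gdist_sym: "gdist adj y z = gdist adj z y"
  using gdist_le[OF walk_rev[OF gdist_walk]] by (metis order_antisym)

lemma gdist_0_iff [simp]: "gdist adj y z = 0 \<longleftrightarrow> y = z"
  using gdist_walk[of y z] gdist_le[of 0 y z] by auto

lemma gdist_refl [simp]: "gdist adj y y = 0"
  by simp

lemma gdist_1_iff: "gdist adj y z = 1 \<longleftrightarrow> adj y z"
proof
  assume "gdist adj y z = 1"
  then show "adj y z" using gdist_walk[of y z] by (auto simp: OO_def)
next
  assume a: "adj y z"
  then have "gdist adj y z \<le> 1" by (intro gdist_le) (simp add: OO_def)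
  moreover have "gdist adj y z \<noteq> 0" using a adj_irrefl by auto
  ultimately show "gdist adj y z = 1" by linarith
qed

lemma sphere_1: "sphere_at adj 1 y = {z. adj y z}"
  unfolding sphere_at_def by (simp only: gdist_1_iff)

lemma gdist_triangle: "gdist adj y z \<le> gdist adj y w + gdist adj w z"
  by (rule gdist_le) (use gdist_walk relpowp_trans in metis)

lemma gdist_adj_le: "adj y w \<Longrightarrow> gdist adj y z \<le> gdist adj w z + 1"
  using gdist_triangle[of y z w] gdist_1_iff[of y w] by simp

lemma gdist_adj_le': "adj y w \<Longrightarrow> gdist adj w z \<le> gdist adj y z + 1"
  using gdist_adj_le adj_sym by blast

lemma gdist_predecessor:
  assumes "gdist adj y z = Suc n"
  obtains w where "adj y w" "gdist adj w z = n"
proof -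
  from gdist_walk[of y z] assms have "(adj ^^ Suc n) y z" by simp
  then obtain w where w: "adj y w" "(adj ^^ n) w z" by (metis relpowp_Suc_D2)
  with gdist_le[OF w(2)] gdist_adj_le[OF w(1), of z] assms show thesis
    by (intro that[of w]) auto
qed

lemma gdist_attained:
  assumes "i \<le> gdiameter adj"
  obtains y z where "gdist adj y z = i"
proof -
  let ?D = "{gdist adj y z | y z. True}"
  have eq: "?D = (\<lambda>(y, z). gdist adj y z) ` UNIV" by auto
  have "Max ?D \<in> ?D" unfolding eq by (rule Max_in) auto
  then obtain y z where yz: "gdist adj y z = gdiameter adj" unfolding gdiameter_def by auto
  from assms have "\<exists>y. gdist adj y z = i"
  proof (induction rule: inc_induct)
    case base
    show ?case using yz by blast
  next
    case (step n)
    then show ?case using gdist_predecessor by metis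
  qed
  then show thesis using that by blast
qed

lemma edge_count:
  assumes "\<And>y. y \<in> S \<Longrightarrow> card {w \<in> T. adj y w} = a" "\<And>w. w \<in> T \<Longrightarrow> card {y \<in> S. adj w y} = b"
  shows "card S * a = card T * b"
proof -
  have "{y \<in> S. adj y w} = {y \<in> S. adj w y}" for w using adj_sym by blast
  then have "(\<Sum>y\<in>S. card {w \<in> T. adj y w}) = b * card T"
    using assms(2) by (intro sum_multicount) auto
  then show ?thesis using assms(1) by (simp add: mult.commute)
qed

end


section \<open>Distance-regularity\<close>

text \<open>A distance-regular graph.\<close>

locale drg = connected_simple_graph +
  assumes dr: "distance_regular adj"
begin

lemma intersection_number_eq:
  assumes "gdist adj y z = h"
  shows "card (sphere_at adj i y \<inter> sphere_at adj j z) = intersection_number adj h i j"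
proof -
  have c: "\<And>y' z'. gdist adj y' z' = h \<Longrightarrow>
      card (sphere_at adj i y' \<inter> sphere_at adj j z') = card (sphere_at adj i y \<inter> sphere_at adj j z)"
    using dr assms unfolding distance_regular_def by metis
  show ?thesis unfolding intersection_number_def
    by (rule the_equality[symmetric]) (use c assms in blast)+
qed

lemma card_b_num: "gdist adj y z = i \<Longrightarrow> card {w. adj y w \<and> gdist adj w z = i + 1} = b_num adj i"
proof -
  assume a: "gdist adj y z = i"
  have "{w. adj y w \<and> gdist adj w z = i + 1} = sphere_at adj 1 y \<inter> sphere_at adj (i + 1) z"
    unfolding sphere_1 by (auto simp: sphere_at_def gdist_sym)
  then show ?thesis using intersection_number_eq[OF a] by (simp add: b_num_def)
qed

lemma card_c_num:
  "gdist adj y z = Suc i \<Longrightarrow> card {w. adj y w \<and> gdist adj w z = i} = c_num adj (Suc i)"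
proof -
  assume a: "gdist adj y z = Suc i"
  have "{w. adj y w \<and> gdist adj w z = i} = sphere_at adj 1 y \<inter> sphere_at adj i z"
    unfolding sphere_1 by (auto simp: sphere_at_def gdist_sym)
  then show ?thesis using intersection_number_eq[OF a] by (simp add: c_num_def)
qed

lemma b_num_pos:
  assumes "i < gdiameter adj"
  shows "b_num adj i > 0"
proof -
  from assms obtain y z where yz: "gdist adj y z = Suc i" using gdist_attained[of "Suc i"] by auto
  then obtain w where w: "adj y w" "gdist adj w z = i" using gdist_predecessor by blast
  have "y \<in> {v. adj w v \<and> gdist adj v z = i + 1}" using w yz adj_sym by simp
  then have "card {v. adj w v \<and> gdist adj v z = i + 1} > 0" by (auto simp: card_gt_0_iff)
  then show ?thesis using card_b_num[OF w(2)] by simp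
qed

lemma c_num_pos:
  assumes "Suc i \<le> gdiameter adj"
  shows "c_num adj (Suc i) > 0"
proof -
  from assms obtain y z where yz: "gdist adj y z = Suc i" using gdist_attained by auto
  then obtain w where w: "adj y w" "gdist adj w z = i" using gdist_predecessor by blast
  then have "card {w. adj y w \<and> gdist adj w z = i} > 0" by (auto simp: card_gt_0_iff)
  then show ?thesis using card_c_num[OF yz] by simp
qed

lemma card_neighbours: "card {w. adj y w} = valency adj"
proof -
  have "{w. adj y w} = {w. adj y w \<and> gdist adj w y = 0 + 1}"
    using gdist_1_iff adj_sym by auto
  then show ?thesis using card_b_num[of y y 0] by (simp add: valency_def)
qed


section \<open>The Bose-Mesner algebra\<close>

lemma bose_mesner_distance:
  "M \<in> bose_mesner adj \<Longrightarrow> \<exists>m. \<forall>y z. M $ y $ z = m (gdist adj y z)"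
proof (induction rule: bose_mesner.induct)
  case one
  show ?case by (rule exI[of _ "\<lambda>n. if n = 0 then 1 else 0"]) (simp add: mat_def)
next
  case gen
  show ?case
    by (rule exI[of _ "\<lambda>n. if n = 1 then 1 else 0"]) (simp only: adj_matrix_def gdist_1_iff vec_lambda_beta simp_thms)
next
  case (add M N)
  then obtain m n where "\<forall>y z. M $ y $ z = m (gdist adj y z)" "\<forall>y z. N $ y $ z = n (gdist adj y z)"
    by blast
  then show ?case by (intro exI[of _ "\<lambda>i. m i + n i"]) simp
next
  case (scale M c)
  then obtain m where "\<forall>y z. M $ y $ z = m (gdist adj y z)" by blast
  then show ?case by (intro exI[of _ "\<lambda>i. c * m i"]) (simp add: mscale_def)
next
  case (mult M N)
  then obtain m n where m: "\<And>y z. M $ y $ z = m (gdist adj y z)"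
    and n: "\<And>y z. N $ y $ z = n (gdist adj y z)" by blast
  \<comment> \<open>The entries of the product are grouped by the two distances to the middle vertex.\<close>
  define D where "D = (\<lambda>(y, z). gdist adj y z) ` (UNIV :: ('a \<times> 'a) set)"
  have D: "finite D" "\<And>y z. gdist adj y z \<in> D" unfolding D_def by (auto simp: image_iff)
  have "(M ** N) $ y $ z =
      (\<Sum>i\<in>D. \<Sum>j\<in>D. of_nat (intersection_number adj (gdist adj y z) i j) * (m i * n j))" for y z
  proof -
    have "(\<Sum>i\<in>D. \<Sum>j\<in>D. of_nat (intersection_number adj (gdist adj y z) i j) * (m i * n j))
        = (\<Sum>i\<in>D. \<Sum>j\<in>D. \<Sum>w\<in>sphere_at adj i y \<inter> sphere_at adj j z. m i * n j)"
      using intersection_number_eq[OF refl, of _ y _ z, symmetric] by simp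
    also have "\<dots> = (\<Sum>i\<in>D. \<Sum>j\<in>D. \<Sum>w\<in>UNIV. if i = gdist adj y w then
        (if j = gdist adj w z then m i * n j else 0) else 0)"
      by (rule sum.cong[OF refl], rule sum.cong[OF refl], rule sum.mono_neutral_cong_left)
        (auto simp: sphere_at_def gdist_sym)
    also have "\<dots> = (\<Sum>w\<in>UNIV. \<Sum>i\<in>D. \<Sum>j\<in>D. if i = gdist adj y w then
        (if j = gdist adj w z then m i * n j else 0) else 0)"
      by (simp only: sum.swap[where A = UNIV and B = D])
    also have "\<dots> = (\<Sum>w\<in>UNIV. \<Sum>i\<in>D. if i = gdist adj y w then m i * n (gdist adj w z) else 0)"
      by (intro sum.cong refl) (auto simp: D sum.delta)
    also have "\<dots> = (\<Sum>w\<in>UNIV. m (gdist adj y w) * n (gdist adj w z))"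
      by (simp add: D sum.delta)
    finally show ?thesis by (simp add: matrix_matrix_mult_def m n)
  qed
  then show ?case
    by (intro exI[of _ "\<lambda>h. \<Sum>i\<in>D. \<Sum>j\<in>D. of_nat (intersection_number adj h i j) * (m i * n j)"]) blast
qed

lemma bose_mesner_symmetric: "M \<in> bose_mesner adj \<Longrightarrow> transpose M = M"
  using bose_mesner_distance[of M] gdist_sym unfolding transpose_def vec_eq_iff by force

lemma bose_mesner_commute:
  assumes "M \<in> bose_mesner adj" "N \<in> bose_mesner adj"
  shows "M ** N = N ** M"
  using assms bose_mesner.mult[OF assms] bose_mesner_symmetric matrix_transpose_mul by metis

text \<open>
  The product of two commuting idempotents is an idempotent below both of them, hence by
  primitivity zero or equal to each.
\<close>

lemma primitive_idempotents_orthogonal: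
  assumes "primitive_idempotent (bose_mesner adj) e" "primitive_idempotent (bose_mesner adj) f" "e \<noteq> f"
  shows "e ** f = 0"
proof -
  have e: "e \<in> bose_mesner adj" "e ** e = e" and f: "f \<in> bose_mesner adj" "f ** f = f"
    using assms unfolding primitive_idempotent_def by auto
  have c: "e ** f = f ** e" using bose_mesner_commute e f by blast
  have ef: "e ** f \<in> bose_mesner adj" using bose_mesner.mult e f by blast
  have 1: "e ** (e ** f) = e ** f" "f ** (e ** f) = e ** f" "(e ** f) ** e = e ** f"
       "(e ** f) ** f = e ** f" "(e ** f) ** (e ** f) = e ** f"
    using e f c by (metis matrix_mul_assoc)+
  have "e ** f = 0 \<or> e ** f = e" "e ** f = 0 \<or> e ** f = f"
    using assms ef 1 unfolding primitive_idempotent_def by blast+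
  then show ?thesis using assms(3) by metis
qed

lemma adj_matrix_mult_idempotent:
  assumes E: "primitive_idempotents_of adj d E"
    and A: "adj_matrix adj = (\<Sum>i=0..d. mscale (\<theta> i) (E i))" and "j \<le> d"
  shows "adj_matrix adj ** E j = mscale (\<theta> j) (E j)"
proof -
  have b: "bij_betw E {0..d} {e. primitive_idempotent (bose_mesner adj) e}"
    using E unfolding primitive_idempotents_of_def by blast
  have p: "primitive_idempotent (bose_mesner adj) (E i)" if "i \<le> d" for i
    using bij_betwE[OF b] that by simp
  have EE: "E i ** E j = (if i = j then E j else 0)" if "i \<le> d" for i
  proof (cases "i = j")
    case True
    then show ?thesis using p[OF that] unfolding primitive_idempotent_def by simp
  next
    case False
    then have "E i \<noteq> E j" using b that \<open>j \<le> d\<close> unfolding bij_betw_def inj_on_def by auto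
    then show ?thesis using primitive_idempotents_orthogonal p that \<open>j \<le> d\<close> False by simp
  qed
  have "(adj_matrix adj ** E j) $ y $ z = mscale (\<theta> j) (E j) $ y $ z" for y z
  proof -
    have "(adj_matrix adj ** E j) $ y $ z = (\<Sum>w\<in>UNIV. \<Sum>i=0..d. \<theta> i * (E i $ y $ w * E j $ w $ z))"
      by (simp add: A matrix_matrix_mult_def mscale_def sum_distrib_right mult.assoc)
    also have "\<dots> = (\<Sum>i=0..d. \<theta> i * (\<Sum>w\<in>UNIV. E i $ y $ w * E j $ w $ z))"
      by (subst sum.swap) (simp add: sum_distrib_left)
    also have "\<dots> = (\<Sum>i=0..d. \<theta> i * (E i ** E j) $ y $ z)"
      by (simp add: matrix_matrix_mult_def)
    also have "\<dots> = (\<Sum>i=0..d. if i = j then \<theta> j * E j $ y $ z else 0)"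
      by (intro sum.cong refl) (simp add: EE)
    also have "\<dots> = mscale (\<theta> j) (E j) $ y $ z" using \<open>j \<le> d\<close> by (simp add: sum.delta' mscale_def)
    finally show ?thesis .
  qed
  then show ?thesis by (simp add: vec_eq_iff)
qed

lemma adj_matrix_mult_entry: "(adj_matrix adj ** M) $ y $ z = (\<Sum>w\<in>{w. adj y w}. M $ w $ z)"
  unfolding matrix_matrix_mult_def adj_matrix_def
  by (simp add: if_distrib[of "\<lambda>u. u * _"] sum.If_cases cong: if_cong)

text \<open>
  The entries of an eigenmatrix of the adjacency matrix are real multiples of its diagonal
  entry: the entry at distance \<open>n + 1\<close> is determined by those at smaller distance through
  the three-term recurrence. Idempotency then makes the diagonal entry a positive real.
\<close>

lemma idempotent_real_entries:
  assumes M: "M \<in> bose_mesner adj" "M \<noteq> 0" "M ** M = M"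
    and AM: "adj_matrix adj ** M = mscale (complex_of_real t) M"
  obtains f :: "nat \<Rightarrow> real" where "f 0 > 0"
    and "\<And>y z. M $ y $ z = complex_of_real (f (gdist adj y z))"
proof -
  obtain m where m: "\<And>y z. M $ y $ z = m (gdist adj y z)" using bose_mesner_distance[OF M(1)] by blast
  have rec: "(\<Sum>w\<in>{w. adj y w}. m (gdist adj w z)) = complex_of_real t * m (gdist adj y z)" for y z
    using arg_cong[OF AM, of "\<lambda>N. N $ y $ z"] by (simp add: adj_matrix_mult_entry mscale_def m)
  \<comment> \<open>The real line spanned by the diagonal entry; all entries are shown to lie on it.\<close>
  define K where "K = range (\<lambda>r. m 0 * complex_of_real r)"
  have K_add: "a + b \<in> K" if ab: "a \<in> K" "b \<in> K" for a b
  proof -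
    from ab obtain r s where "a = m 0 * complex_of_real r" "b = m 0 * complex_of_real s"
      unfolding K_def by auto
    then have "a + b = m 0 * complex_of_real (r + s)" by (simp add: distrib_left)
    then show ?thesis unfolding K_def by blast
  qed
  have K_scale: "complex_of_real c * a \<in> K" if a: "a \<in> K" for a c
  proof -
    from a obtain r where "a = m 0 * complex_of_real r" unfolding K_def by auto
    then have "complex_of_real c * a = m 0 * complex_of_real (c * r)" by simp
    then show ?thesis unfolding K_def by blast
  qed
  have K0: "0 \<in> K" unfolding K_def by (metis mult_zero_right of_real_0 rangeI)
  have K_sum: "(\<forall>w\<in>S. g w \<in> K) \<Longrightarrow> sum g S \<in> K" for g and S :: "'a set"
    by (induction S rule: infinite_finite_induct) (auto intro: K0 K_add)
  have "\<forall>y z. gdist adj y z = n \<longrightarrow> m n \<in> K" for n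
  proof (induction n rule: less_induct)
    case (less n)
    show ?case
    proof (cases n)
      case 0
      have "m 0 = m 0 * complex_of_real 1" by simp
      then show ?thesis unfolding K_def 0 by blast
    next
      case (Suc l)
      show ?thesis
      proof (intro allI impI)
        fix y z assume yz: "gdist adj y z = n"
        then obtain w where w: "adj y w" "gdist adj w z = l" using gdist_predecessor Suc by blast
        let ?S = "{v. adj w v}" let ?P = "\<lambda>v. gdist adj v z = n"
        have lt: "gdist adj v z < n" if "adj w v" "gdist adj v z \<noteq> n" for v
          using gdist_adj_le'[OF that(1), of z] that(2) w(2) Suc by linarith
        have "(\<Sum>v\<in>?S. m (gdist adj v z)) =
            (\<Sum>v\<in>{v. adj w v \<and> ?P v}. m (gdist adj v z)) +
            (\<Sum>v\<in>{v. adj w v \<and> \<not> ?P v}. m (gdist adj v z))"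
          by (subst sum.union_disjoint[symmetric]) (auto intro!: sum.cong)
        moreover have "(\<Sum>v\<in>{v. adj w v \<and> ?P v}. m (gdist adj v z)) =
            (\<Sum>v\<in>{v. adj w v \<and> ?P v}. m n)"
          by (intro sum.cong refl) simp
        ultimately have "of_nat (card {v. adj w v \<and> ?P v}) * m n = complex_of_real t * m l +
            complex_of_real (-1) * (\<Sum>v\<in>{v. adj w v \<and> \<not> ?P v}. m (gdist adj v z))" (is "_ = ?R")
          using rec[where y = w and z = z] w(2) by simp
        moreover have "?R \<in> K"
          using less lt w Suc by (intro K_add K_scale K_sum ballI) auto
        moreover have "y \<in> {v. adj w v \<and> ?P v}" using w(1) yz adj_sym by simp
        then have pos: "card {v. adj w v \<and> ?P v} > 0" by (auto simp: card_gt_0_iff)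
        define c where "c = card {v. adj w v \<and> ?P v}"
        ultimately have "complex_of_real (1 / c) * (of_nat c * m n) \<in> K"
          unfolding c_def using K_scale by metis
        then show "m n \<in> K" using pos unfolding c_def[symmetric] by simp
      qed
    qed
  qed
  then have "\<And>y z. \<exists>r. m (gdist adj y z) = m 0 * complex_of_real r" unfolding K_def by blast
  then have "\<forall>n. \<exists>r. \<forall>y z. gdist adj y z = n \<longrightarrow> m n = m 0 * complex_of_real r" by metis
  then obtain u where u: "\<And>y z. m (gdist adj y z) = m 0 * complex_of_real (u (gdist adj y z))" by metis
  define x0 :: 'a where "x0 = undefined"
  have m0: "m 0 \<noteq> 0"
  proof
    assume "m 0 = 0"
    then have "M = 0" using m u by (simp add: vec_eq_iff)
    then show False using M(2) by simp
  qed
  \<comment> \<open>The diagonal entry of \<open>M\<^sup>2 = M\<close> reads \<open>(m 0)\<^sup>2 S = m 0\<close>.\<close>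
  define S where "S = (\<Sum>w\<in>UNIV. (u (gdist adj x0 w))\<^sup>2)"
  have "m 0 = (M ** M) $ x0 $ x0" using M(3) m[of x0 x0] by simp
  also have "\<dots> = (\<Sum>w\<in>UNIV. m (gdist adj x0 w) * m (gdist adj x0 w))"
    unfolding matrix_matrix_mult_def by (simp add: m gdist_sym)
  also have "\<dots> = (\<Sum>w\<in>UNIV. (m 0)\<^sup>2 * complex_of_real ((u (gdist adj x0 w))\<^sup>2))"
    by (subst u, subst u) (simp add: power2_eq_square mult_ac)
  also have "\<dots> = (m 0)\<^sup>2 * complex_of_real S" unfolding S_def by (simp add: sum_distrib_left)
  finally have "m 0 * complex_of_real S = 1" using m0 by (simp add: power2_eq_square)
  then have S0: "S \<noteq> 0" and mS: "m 0 = complex_of_real (1 / S)"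
    by (auto simp: eq_divide_eq)
  have "S \<ge> 0" unfolding S_def by (intro sum_nonneg) simp
  with S0 have Spos: "S > 0" by simp
  have u0: "u 0 = 1" using u[of x0 x0] m0 by simp
  show thesis
  proof (rule that[of "\<lambda>n. u n / S"])
    show "u 0 / S > 0" using u0 Spos by simp
    show "M $ y $ z = complex_of_real (u (gdist adj y z) / S)" for y z
      using m[of y z] u[of y z] mS by simp
  qed
qed

end



section \<open>Delsarte cliques\<close>

text \<open>
  Here \<open>f\<close> lists the entries, by distance, of a nonzero idempotent of the Bose-Mesner
  algebra on which the adjacency matrix acts as the real number \<open>t\<close>.
\<close>

locale drg_idempotent = drg +
  fixes f :: "nat \<Rightarrow> real" and t :: real
  assumes f_0_pos: "f 0 > 0"
    and eigen: "(\<Sum>w\<in>{w. adj y w}. f (gdist adj w z)) = t * f (gdist adj y z)"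
    and idem: "(\<Sum>w\<in>UNIV. f (gdist adj y w) * f (gdist adj w z)) = f (gdist adj y z)"
begin

lemma valency_mult_f_1: "real (valency adj) * f 1 = t * f 0"
proof -
  fix y :: 'a
  have "(\<Sum>w\<in>{w. adj y w}. f (gdist adj w y)) = (\<Sum>w\<in>{w. adj y w}. f 1)"
    using adj_sym gdist_1_iff by (intro sum.cong refl) (metis mem_Collect_eq)
  then show ?thesis using eigen[where y = y and z = y] by (simp add: card_neighbours)
qed

text \<open>
  By the recurrence at distance \<open>i\<close>, vanishing at \<open>i\<close> and \<open>i + 1\<close> propagates down to \<open>0\<close>.
\<close>

lemma no_consecutive_zeros:
  assumes "i < gdiameter adj" "f i = 0"
  shows "f (Suc i) \<noteq> 0"
  using assms
proof (induction i)
  case 0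
  then show ?case using f_0_pos by simp
next
  case (Suc i)
  show ?case
  proof
    assume f2: "f (Suc (Suc i)) = 0"
    obtain y z where yz: "gdist adj y z = Suc i" using Suc.prems gdist_attained[of "Suc i"] by auto
    have zero: "f (gdist adj w z) = 0" if "adj y w" "gdist adj w z \<noteq> i" for w
    proof -
      have "gdist adj w z = Suc i \<or> gdist adj w z = Suc (Suc i)"
        using gdist_adj_le[OF that(1), of z] gdist_adj_le'[OF that(1), of z] yz that(2) by linarith
      then show ?thesis using f2 Suc.prems by auto
    qed
    have "(\<Sum>w\<in>{w. adj y w}. f (gdist adj w z)) = (\<Sum>w\<in>{w. adj y w \<and> gdist adj w z = i}. f i)"
      by (rule sum.mono_neutral_cong_right) (use zero in auto)
    also have "\<dots> = real (c_num adj (Suc i)) * f i" using card_c_num[OF yz] by simp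
    finally have "real (c_num adj (Suc i)) * f i = 0"
      using eigen[where y = y and z = z] yz Suc.prems by simp
    then have "f i = 0" using c_num_pos[of i] Suc.prems by simp
    then show False using Suc.IH Suc.prems by simp
  qed
qed

text \<open>
  If \<open>M\<close> is the idempotent and \<open>u\<close> the characteristic vector of a Delsarte clique, then
  \<open>\<parallel>M u\<parallel>\<^sup>2 = u\<^sup>t M u\<close> vanishes.
\<close>

lemma Delsarte_clique_kernel:
  assumes C: "Delsarte_clique adj t C" and "t \<noteq> 0"
  shows "(\<Sum>w\<in>C. f (gdist adj y w)) = 0"
proof -
  have ne: "C \<noteq> {}" and cl: "\<And>y z. y \<in> C \<Longrightarrow> z \<in> C \<Longrightarrow> y \<noteq> z \<Longrightarrow> adj y z"
    and card: "real (card C) = 1 - real (valency adj) / t"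
    using C unfolding Delsarte_clique_def by auto
  have row: "(\<Sum>z\<in>C. f (gdist adj w z)) = 0" if "w \<in> C" for w
  proof -
    have "(\<Sum>z\<in>C. f (gdist adj w z)) = f 0 + (\<Sum>z\<in>C - {w}. f (gdist adj w z))"
      using that by (subst sum.remove[of _ w]) auto
    also have "(\<Sum>z\<in>C - {w}. f (gdist adj w z)) = (\<Sum>z\<in>C - {w}. f 1)"
      using cl that gdist_1_iff by (intro sum.cong refl) (metis DiffE singletonI)
    also have "\<dots> = (real (card C) - 1) * f 1"
      using that card_gt_0_iff[of C] by (auto simp: card_Diff_singleton of_nat_diff Suc_le_eq)
    also have "(real (card C) - 1) * f 1 = - f 0"
      using valency_mult_f_1 \<open>t \<noteq> 0\<close> by (simp add: card field_simps)
    finally show ?thesis by simp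
  qed
  have "(\<Sum>v\<in>UNIV. (\<Sum>w\<in>C. f (gdist adj v w))\<^sup>2)
      = (\<Sum>v\<in>UNIV. \<Sum>w\<in>C. \<Sum>z\<in>C. f (gdist adj w v) * f (gdist adj v z))"
    unfolding power2_eq_square by (simp add: sum_product gdist_sym)
  also have "\<dots> = (\<Sum>w\<in>C. \<Sum>z\<in>C. \<Sum>v\<in>UNIV. f (gdist adj w v) * f (gdist adj v z))"
    by (subst sum.swap, rule sum.cong[OF refl], subst sum.swap) (rule refl)
  also have "\<dots> = 0" by (simp add: idem row)
  finally have "\<forall>v\<in>UNIV. (\<Sum>w\<in>C. f (gdist adj v w))\<^sup>2 = 0"
    by (subst (asm) sum_nonneg_eq_0_iff) auto
  then show ?thesis by simp
qed

end

text \<open>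
  A clique whose characteristic vector is annihilated by the idempotent. No size is
  prescribed; \<open>|C| \<ge> 2\<close> follows from the vanishing.
\<close>

locale clique_in_kernel = drg_idempotent +
  fixes C :: "'a::finite set"
  assumes nonempty: "C \<noteq> {}"
    and clique: "y \<in> C \<Longrightarrow> z \<in> C \<Longrightarrow> y \<noteq> z \<Longrightarrow> adj y z"
    and kernel: "(\<Sum>w\<in>C. f (gdist adj y w)) = 0"
begin

lemma in_cell_iff:
  "y \<in> clique_cell adj C i \<longleftrightarrow> (\<forall>w\<in>C. i \<le> gdist adj y w) \<and> (\<exists>w\<in>C. gdist adj y w = i)"
proof -
  have "dist_set adj y C = i \<longleftrightarrow> (\<forall>w\<in>C. i \<le> gdist adj y w) \<and> (\<exists>w\<in>C. gdist adj y w = i)"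
    unfolding dist_set_def using nonempty by (subst Min_eq_iff) auto
  then show ?thesis unfolding clique_cell_def by simp
qed

lemma clique_dist_le: "v \<in> C \<Longrightarrow> w \<in> C \<Longrightarrow> gdist adj v w \<le> 1"
  using clique[of v w] gdist_1_iff[of v w] by (cases "v = w") auto

lemma cell_dist:
  assumes "y \<in> clique_cell adj C i" "w \<in> C"
  shows "gdist adj y w = i \<or> gdist adj y w = Suc i"
proof -
  from assms obtain v where v: "v \<in> C" "gdist adj y v = i" and ge: "i \<le> gdist adj y w"
    unfolding in_cell_iff by blast
  with gdist_triangle[of y w v] clique_dist_le[OF v(1) assms(2)] show ?thesis by linarith
qed

lemma in_cellI:
  assumes "\<And>w. w \<in> C \<Longrightarrow> i \<le> gdist adj y w" "v \<in> C" "gdist adj y v = i"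
  shows "y \<in> clique_cell adj C i"
  using assms unfolding in_cell_iff by blast

text \<open>
  The number of members of \<open>C\<close> at distance \<open>i\<close> from \<open>y\<close>; for \<open>y\<close> in \<open>C\<^sub>i\<close> these are the
  nearest ones, and all others are at distance \<open>i + 1\<close>.
\<close>

definition near :: "'a \<Rightarrow> nat \<Rightarrow> nat" where
  "near y i = card {w \<in> C. gdist adj y w = i}"

lemma near_pos: "y \<in> clique_cell adj C i \<Longrightarrow> near y i > 0"
  unfolding near_def in_cell_iff by (auto simp: card_gt_0_iff)

lemma near_Suc:
  assumes "y \<in> clique_cell adj C i"
  shows "near y i + near y (Suc i) = card C"
proof -
  have "C = {w \<in> C. gdist adj y w = i} \<union> {w \<in> C. gdist adj y w = Suc i}"
    using cell_dist[OF assms] by auto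
  then have "card C = card ({w \<in> C. gdist adj y w = i} \<union> {w \<in> C. gdist adj y w = Suc i})" by simp
  also have "\<dots> = near y i + near y (Suc i)"
    unfolding near_def by (rule card_Un_disjoint) auto
  finally show ?thesis by simp
qed

lemma near_kernel:
  assumes "y \<in> clique_cell adj C i"
  shows "real (near y i) * f i + (real (card C) - real (near y i)) * f (Suc i) = 0"
proof -
  have "(\<Sum>w\<in>C. f (gdist adj y w)) = (\<Sum>w\<in>{w \<in> C. gdist adj y w = i}. f (gdist adj y w))
      + (\<Sum>w\<in>{w \<in> C. gdist adj y w = Suc i}. f (gdist adj y w))"
    by (subst sum.union_disjoint[symmetric]) (use cell_dist[OF assms] in \<open>auto intro!: sum.cong\<close>)
  also have "\<dots> = real (near y i) * f i + real (near y (Suc i)) * f (Suc i)"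
    unfolding near_def by simp
  also have "real (near y (Suc i)) = real (card C) - real (near y i)"
    using near_Suc[OF assms] by linarith
  finally show ?thesis using kernel by simp
qed

text \<open>
  The number of nearest clique members depends only on the distance to the clique: otherwise
  \<open>f i = f (i + 1)\<close>, and then both vanish, which is impossible for consecutive values.
\<close>

lemma near_eq:
  assumes i: "i < gdiameter adj" and y: "y \<in> clique_cell adj C i" and z: "z \<in> clique_cell adj C i"
  shows "near y i = near z i"
proof (rule ccontr)
  assume ne: "near y i \<noteq> near z i"
  have "(real (near y i) - real (near z i)) * (f i - f (Suc i)) = 0"
    using near_kernel[OF y] near_kernel[OF z] by (simp add: algebra_simps)
  then have eq: "f i = f (Suc i)" using ne by simp
  then have "real (card C) * f i = 0" using near_kernel[OF y] by (simp add: algebra_simps)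
  then have "f i = 0" using nonempty by simp
  then show False using no_consecutive_zeros[OF i] eq by simp
qed

lemma card_clique: "card C \<ge> 2"
proof -
  obtain y where y: "y \<in> C" using nonempty by blast
  have "card C \<noteq> 1"
  proof
    assume "card C = 1"
    then have "C = {y}" using y by (auto simp: card_1_singleton_iff)
    then show False using kernel[of y] f_0_pos by simp
  qed
  moreover have "card C \<noteq> 0" using nonempty by simp
  ultimately show ?thesis by linarith
qed

end


section \<open>Cells relative to a vertex of the clique\<close>

text \<open>
  With a fixed vertex \<open>x\<close> of the clique, neighbours in \<open>C\<^sub>i\<^sub>+\<^sub>1\<close> of a vertex of \<open>C\<^sub>i\<^sup>-\<close> lie in
  \<open>C\<^sub>i\<^sub>+\<^sub>1\<^sup>-\<close>, and those of a vertex of \<open>C\<^sub>i\<^sup>+\<close> that are farther from \<open>x\<close> lie in \<open>C\<^sub>i\<^sub>+\<^sub>1\<^sup>+\<close>;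
  the same holds downwards with the two conditions interchanged. Hence the edges between
  consecutive cells of equal sign are counted by \<open>b~\<^sub>i\<close> and \<open>c\<^sub>i\<^sub>+\<^sub>1\<close>, respectively by \<open>b\<^sub>i\<^sub>+\<^sub>1\<close>
  and \<open>c~\<^sub>i\<^sub>+\<^sub>1\<close>.
\<close>

locale clique_vertex = clique_in_kernel +
  fixes x :: "'a::finite"
  assumes x_in: "x \<in> C"
begin

lemma in_minus_iff:
  "y \<in> clique_minus adj C x i \<longleftrightarrow> y \<in> clique_cell adj C i \<and> gdist adj y x = i"
  unfolding clique_minus_def sphere_at_def by (auto simp: gdist_sym)

lemma in_plus_iff:
  "y \<in> clique_plus adj C x i \<longleftrightarrow> y \<in> clique_cell adj C i \<and> gdist adj y x = Suc i"
  unfolding clique_plus_def sphere_at_def by (auto simp: gdist_sym)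

lemma clique_minus_0: "clique_minus adj C x 0 = {x}"
  using x_in by (auto simp: in_minus_iff in_cell_iff)

lemma clique_plus_0: "clique_plus adj C x 0 = C - {x}"
proof -
  have "y \<in> C \<and> y \<noteq> x \<longleftrightarrow> y \<in> clique_plus adj C x 0" for y
    using x_in clique_dist_le[of y x] by (auto simp: in_plus_iff in_cell_iff le_Suc_eq)
  then show ?thesis by blast
qed

lemma minus_step_up:
  assumes y: "y \<in> clique_minus adj C x i" and w: "adj y w"
  shows "w \<in> clique_cell adj C (Suc i) \<longleftrightarrow> w \<in> clique_minus adj C x (Suc i)"
  using assms gdist_adj_le'[OF w, of x] x_in
  by (auto simp: in_minus_iff in_cell_iff intro: antisym)

lemma minus_step_down:
  assumes y: "y \<in> clique_minus adj C x (Suc i)" and w: "adj y w"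
  shows "gdist adj w x = i \<longleftrightarrow> w \<in> clique_minus adj C x i"
proof
  assume wx: "gdist adj w x = i"
  have "i \<le> gdist adj w v" if "v \<in> C" for v
    using y that gdist_adj_le[OF w, of v] by (force simp: in_minus_iff in_cell_iff)
  then show "w \<in> clique_minus adj C x i" using wx x_in by (auto simp: in_minus_iff intro: in_cellI)
qed (simp add: in_minus_iff)

lemma plus_step_up:
  assumes y: "y \<in> clique_plus adj C x i" and w: "adj y w"
  shows "gdist adj w x = Suc (Suc i) \<longleftrightarrow> w \<in> clique_plus adj C x (Suc i)"
proof
  assume wx: "gdist adj w x = Suc (Suc i)"
  obtain v where v: "v \<in> C" "gdist adj y v = i" using y by (auto simp: in_plus_iff in_cell_iff)
  have ge: "Suc i \<le> gdist adj w u" if "u \<in> C" for u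
    using clique_dist_le[OF that x_in] gdist_triangle[of w x u] wx by linarith
  moreover have "gdist adj w v = Suc i" using ge[OF v(1)] gdist_adj_le'[OF w, of v] v(2) by linarith
  ultimately show "w \<in> clique_plus adj C x (Suc i)"
    using wx v(1) by (auto simp: in_plus_iff intro: in_cellI)
qed (simp add: in_plus_iff)

lemma plus_step_down:
  assumes y: "y \<in> clique_plus adj C x (Suc i)" and w: "adj y w"
  shows "w \<in> clique_cell adj C i \<longleftrightarrow> w \<in> clique_plus adj C x i"
  using y cell_dist[of w i x] x_in gdist_adj_le[OF w, of x] by (auto simp: in_plus_iff)

lemma clique_plus_nonempty:
  assumes "i < gdiameter adj"
  shows "clique_plus adj C x i \<noteq> {}"
  using assms
proof (induction i)
  case 0
  have "card (C - {x}) > 0" using card_clique x_in by (simp add: card_Diff_singleton)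
  then show ?case unfolding clique_plus_0 by (metis card.empty less_irrefl)
next
  case (Suc i)
  then obtain y where y: "y \<in> clique_plus adj C x i" by auto
  then have "card {w. adj y w \<and> gdist adj w x = Suc i + 1} > 0"
    using card_b_num[of y x "Suc i"] b_num_pos[of "Suc i"] Suc.prems by (simp add: in_plus_iff)
  then obtain w where "adj y w" "gdist adj w x = Suc (Suc i)" by (auto simp: card_gt_0_iff)
  then show ?case using plus_step_up[OF y] by blast
qed

text \<open>
  A vertex of the nonempty set \<open>C\<^sub>i\<^sup>+\<close> is at distance \<open>i + 1\<close> from \<open>x\<close>, so no vertex of \<open>C\<^sub>i\<close>
  is at distance \<open>i\<close> from the whole clique.
\<close>

lemma near_Suc_pos:
  assumes "i < gdiameter adj" "y \<in> clique_cell adj C i"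
  shows "near y (Suc i) > 0"
proof -
  obtain z where z: "z \<in> clique_plus adj C x i" using clique_plus_nonempty assms(1) by blast
  then have zc: "z \<in> clique_cell adj C i" by (simp add: in_plus_iff)
  have "near z (Suc i) > 0" using z x_in unfolding near_def by (auto simp: card_gt_0_iff in_plus_iff)
  then show ?thesis using near_eq[OF assms(1) zc assms(2)] near_Suc[OF zc] near_Suc[OF assms(2)] by linarith
qed

text \<open>
  Double counting of the pairs \<open>(z, w)\<close> with \<open>z\<close> adjacent to \<open>y\<close>, with \<open>w\<close> in the clique
  and with \<open>\<partial>(z, w)\<close> prescribed.
\<close>

lemma c_tilde_balance:
  assumes y: "y \<in> clique_cell adj C (Suc i)" and i: "i < gdiameter adj" and z: "z \<in> clique_cell adj C i"
  shows "card {w. adj y w \<and> w \<in> clique_cell adj C i} * near z i = near y (Suc i) * c_num adj (Suc i)"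
proof -
  have ge: "i \<le> gdist adj v w" if "adj y v" "w \<in> C" for v w
    using y that(2) gdist_adj_le[OF that(1), of w] by (force simp: in_cell_iff)
  have cell: "v \<in> clique_cell adj C i \<longleftrightarrow> (\<exists>w\<in>C. gdist adj v w = i)" if "adj y v" for v
    using ge[OF that] unfolding in_cell_iff by blast
  have "(\<Sum>v\<in>{v. adj y v}. card {w \<in> C. gdist adj v w = i})
      = (\<Sum>w\<in>C. if gdist adj y w = Suc i then c_num adj (Suc i) else 0)"
  proof (rule sum_multicount_gen; (intro ballI)?)
    fix w assume w: "w \<in> C"
    show "card {v \<in> {v. adj y v}. gdist adj v w = i} = (if gdist adj y w = Suc i then c_num adj (Suc i) else 0)"
    proof (cases "gdist adj y w = Suc i")
      case True
      then show ?thesis using card_c_num[OF True] by simp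
    next
      case False
      then have "gdist adj y w = Suc (Suc i)" using cell_dist[OF y w] by blast
      then have "{v \<in> {v. adj y v}. gdist adj v w = i} = {}" using gdist_adj_le[of y _ w] by force
      then show ?thesis using False by simp
    qed
  qed auto
  also have "\<dots> = near y (Suc i) * c_num adj (Suc i)" unfolding near_def by (simp add: sum.If_cases Int_def)
  also have "(\<Sum>v\<in>{v. adj y v}. card {w \<in> C. gdist adj v w = i})
      = (\<Sum>v\<in>{v. adj y v \<and> v \<in> clique_cell adj C i}. near z i)"
  proof (rule sum.mono_neutral_cong_right)
    show "\<forall>v\<in>{v. adj y v} - {v. adj y v \<and> v \<in> clique_cell adj C i}. card {w \<in> C. gdist adj v w = i} = 0"
      using cell by auto
    show "card {w \<in> C. gdist adj v w = i} = near z i"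
      if "v \<in> {v. adj y v \<and> v \<in> clique_cell adj C i}" for v
      using near_eq[OF i, of v z] that z unfolding near_def by simp
  qed auto
  finally show ?thesis by simp
qed

lemma b_tilde_balance:
  assumes y: "y \<in> clique_cell adj C i" and i: "Suc i < gdiameter adj"
    and z: "z \<in> clique_cell adj C (Suc i)"
  shows "card {w. adj y w \<and> w \<in> clique_cell adj C (Suc i)} * near z (Suc (Suc i)) =
    near y (Suc i) * b_num adj (Suc i)"
proof -
  have cell: "v \<in> clique_cell adj C (Suc i)" if v: "adj y v" "w \<in> C" "gdist adj v w = Suc (Suc i)" for v w
  proof -
    obtain u where u: "u \<in> C" "gdist adj y u = i" using y unfolding in_cell_iff by blast
    have ge: "Suc i \<le> gdist adj v u'" if "u' \<in> C" for u'
      using clique_dist_le[OF that v(2)] gdist_triangle[of v w u'] v(3) by linarith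
    moreover have "gdist adj v u = Suc i" using ge[OF u(1)] gdist_adj_le'[OF v(1), of u] u(2) by linarith
    ultimately show ?thesis using u(1) by (auto intro: in_cellI)
  qed
  have "(\<Sum>v\<in>{v. adj y v}. card {w \<in> C. gdist adj v w = Suc (Suc i)})
      = (\<Sum>w\<in>C. if gdist adj y w = Suc i then b_num adj (Suc i) else 0)"
  proof (rule sum_multicount_gen; (intro ballI)?)
    fix w assume w: "w \<in> C"
    show "card {v \<in> {v. adj y v}. gdist adj v w = Suc (Suc i)} =
        (if gdist adj y w = Suc i then b_num adj (Suc i) else 0)"
    proof (cases "gdist adj y w = Suc i")
      case True
      then show ?thesis using card_b_num[OF True] by simp
    next
      case False
      then have "gdist adj y w = i" using cell_dist[OF y w] by blast
      then have "{v \<in> {v. adj y v}. gdist adj v w = Suc (Suc i)} = {}"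
        using gdist_adj_le'[of y _ w] by force
      then show ?thesis using False by simp
    qed
  qed auto
  also have "\<dots> = near y (Suc i) * b_num adj (Suc i)" unfolding near_def by (simp add: sum.If_cases Int_def)
  also have "(\<Sum>v\<in>{v. adj y v}. card {w \<in> C. gdist adj v w = Suc (Suc i)})
      = (\<Sum>v\<in>{v. adj y v \<and> v \<in> clique_cell adj C (Suc i)}. near z (Suc (Suc i)))"
  proof (rule sum.mono_neutral_cong_right)
    show "\<forall>v\<in>{v. adj y v} - {v. adj y v \<and> v \<in> clique_cell adj C (Suc i)}.
        card {w \<in> C. gdist adj v w = Suc (Suc i)} = 0"
      using cell by auto
    show "card {w \<in> C. gdist adj v w = Suc (Suc i)} = near z (Suc (Suc i))"
      if v: "v \<in> {v. adj y v \<and> v \<in> clique_cell adj C (Suc i)}" for v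
    proof -
      have vc: "v \<in> clique_cell adj C (Suc i)" using v by simp
      have "near v (Suc (Suc i)) = near z (Suc (Suc i))"
        using near_eq[OF i vc z] near_Suc[OF vc] near_Suc[OF z] by linarith
      then show ?thesis unfolding near_def by simp
    qed
  qed auto
  finally show ?thesis by simp
qed

lemma cell_nonempty: "i < gdiameter adj \<Longrightarrow> \<exists>z. z \<in> clique_cell adj C i"
  using clique_plus_nonempty in_plus_iff by blast

lemma neighbours_in: "sphere_at adj 1 y \<inter> Y = {w. adj y w \<and> w \<in> Y}"
  unfolding sphere_1 by blast

lemma card_c_tilde:
  assumes y: "y \<in> clique_cell adj C (Suc i)" and i: "Suc i < gdiameter adj"
  shows "card {w. adj y w \<and> w \<in> clique_cell adj C i} = c_tilde adj C (Suc i)"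
proof -
  obtain z where z: "z \<in> clique_cell adj C i" using cell_nonempty i by (meson Suc_lessD)
  have "card {w. adj v w \<and> w \<in> clique_cell adj C i} = card {w. adj y w \<and> w \<in> clique_cell adj C i}"
    if v: "v \<in> clique_cell adj C (Suc i)" for v
  proof -
    have "card {w. adj v w \<and> w \<in> clique_cell adj C i} * near z i =
        card {w. adj y w \<and> w \<in> clique_cell adj C i} * near z i"
      using c_tilde_balance[OF v _ z] c_tilde_balance[OF y _ z] near_eq[OF i v y] i by simp
    then show ?thesis using near_pos[OF z] by simp
  qed
  then show ?thesis unfolding c_tilde_def neighbours_in diff_Suc_1 using y
    by (intro the_equality[symmetric]) metis+
qed

lemma card_b_tilde:
  assumes y: "y \<in> clique_cell adj C i" and i: "Suc i < gdiameter adj"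
  shows "card {w. adj y w \<and> w \<in> clique_cell adj C (Suc i)} = b_tilde adj C i"
proof -
  obtain z where z: "z \<in> clique_cell adj C (Suc i)" using cell_nonempty i by blast
  have "card {w. adj v w \<and> w \<in> clique_cell adj C (Suc i)} =
      card {w. adj y w \<and> w \<in> clique_cell adj C (Suc i)}"
    if v: "v \<in> clique_cell adj C i" for v
  proof -
    have "near v (Suc i) = near y (Suc i)"
      using near_eq[of i v y] i v y near_Suc[OF v] near_Suc[OF y] by simp
    then have "card {w. adj v w \<and> w \<in> clique_cell adj C (Suc i)} * near z (Suc (Suc i)) =
        card {w. adj y w \<and> w \<in> clique_cell adj C (Suc i)} * near z (Suc (Suc i))"
      using b_tilde_balance[OF v i z] b_tilde_balance[OF y i z] by simp
    then show ?thesis using near_Suc_pos[OF i z] by simp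
  qed
  then show ?thesis unfolding b_tilde_def neighbours_in Suc_eq_plus1[symmetric] using y
    by (intro the_equality[symmetric]) metis+
qed

lemma c_tilde_pos:
  assumes "Suc i < gdiameter adj"
  shows "c_tilde adj C (Suc i) > 0"
proof -
  obtain y where y: "y \<in> clique_cell adj C (Suc i)" using cell_nonempty assms by blast
  obtain z where z: "z \<in> clique_cell adj C i" using cell_nonempty assms by (meson Suc_lessD)
  have "near y (Suc i) * c_num adj (Suc i) > 0" using near_pos[OF y] c_num_pos[of i] assms by simp
  then show ?thesis
    using c_tilde_balance[OF y _ z] card_c_tilde[OF y assms] assms by (cases "c_tilde adj C (Suc i)") auto
qed

lemma b_tilde_pos:
  assumes "Suc i < gdiameter adj"
  shows "b_tilde adj C i > 0"
proof -
  obtain y where y: "y \<in> clique_cell adj C i" using cell_nonempty assms by (meson Suc_lessD)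
  obtain z where z: "z \<in> clique_cell adj C (Suc i)" using cell_nonempty assms by blast
  have "near y (Suc i) * b_num adj (Suc i) > 0" using near_Suc_pos[OF _ y] b_num_pos[of "Suc i"] assms by simp
  then show ?thesis
    using b_tilde_balance[OF y assms z] card_b_tilde[OF y assms] by (cases "b_tilde adj C i") auto
qed

lemma card_minus_step:
  assumes "Suc i < gdiameter adj"
  shows "card (clique_minus adj C x i) * b_tilde adj C i =
    card (clique_minus adj C x (Suc i)) * c_num adj (Suc i)"
proof (rule edge_count)
  fix y assume y: "y \<in> clique_minus adj C x i"
  have "{w \<in> clique_minus adj C x (Suc i). adj y w} = {w. adj y w \<and> w \<in> clique_cell adj C (Suc i)}"
    using minus_step_up[OF y] by blast
  then show "card {w \<in> clique_minus adj C x (Suc i). adj y w} = b_tilde adj C i"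
    using card_b_tilde[OF _ assms] y by (simp add: in_minus_iff)
next
  fix w assume w: "w \<in> clique_minus adj C x (Suc i)"
  have "{y \<in> clique_minus adj C x i. adj w y} = {y. adj w y \<and> gdist adj y x = i}"
    using minus_step_down[OF w] by blast
  then show "card {y \<in> clique_minus adj C x i. adj w y} = c_num adj (Suc i)"
    using card_c_num[of w x i] w by (simp add: in_minus_iff)
qed

lemma card_plus_step:
  assumes "Suc i < gdiameter adj"
  shows "card (clique_plus adj C x i) * b_num adj (Suc i) =
    card (clique_plus adj C x (Suc i)) * c_tilde adj C (Suc i)"
proof (rule edge_count)
  fix y assume y: "y \<in> clique_plus adj C x i"
  have "{w \<in> clique_plus adj C x (Suc i). adj y w} = {w. adj y w \<and> gdist adj w x = Suc i + 1}"
    using plus_step_up[OF y] by auto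
  then show "card {w \<in> clique_plus adj C x (Suc i). adj y w} = b_num adj (Suc i)"
    using card_b_num[of y x "Suc i"] y by (simp add: in_plus_iff)
next
  fix w assume w: "w \<in> clique_plus adj C x (Suc i)"
  have "{y \<in> clique_plus adj C x i. adj w y} = {y. adj w y \<and> y \<in> clique_cell adj C i}"
    using plus_step_down[OF w] by blast
  then show "card {y \<in> clique_plus adj C x i. adj w y} = c_tilde adj C (Suc i)"
    using card_c_tilde[OF _ assms] w by (simp add: in_plus_iff)
qed

lemma card_minus:
  assumes "i < gdiameter adj"
  shows "real (card (clique_minus adj C x i)) =
    (\<Prod>j=0..<i. real (b_tilde adj C j)) / (\<Prod>j=1..i. real (c_num adj j))"
  using assms
proof (induction i)
  case 0
  then show ?case by (simp add: clique_minus_0)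
next
  case (Suc i)
  have "real (card (clique_minus adj C x (Suc i))) * real (c_num adj (Suc i)) =
      real (card (clique_minus adj C x i)) * real (b_tilde adj C i)"
    using card_minus_step[OF Suc.prems] by (metis of_nat_mult)
  moreover have "real (c_num adj (Suc i)) \<noteq> 0" using c_num_pos[of i] Suc.prems by simp
  ultimately have "real (card (clique_minus adj C x (Suc i))) =
      real (card (clique_minus adj C x i)) * real (b_tilde adj C i) / real (c_num adj (Suc i))"
    by (simp add: field_simps)
  then show ?case using Suc by simp
qed

lemma card_plus:
  assumes "i < gdiameter adj"
  shows "real (card (clique_plus adj C x i)) =
    (\<Prod>j=1..i. real (b_num adj j)) / (\<Prod>j=1..i. real (c_tilde adj C j)) * (real (card C) - 1)"
  using assms
proof (induction i)
  case 0
  then show ?case using x_in card_clique by (simp add: clique_plus_0 card_Diff_singleton of_nat_diff)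
next
  case (Suc i)
  have "real (card (clique_plus adj C x (Suc i))) * real (c_tilde adj C (Suc i)) =
      real (card (clique_plus adj C x i)) * real (b_num adj (Suc i))"
    using card_plus_step[OF Suc.prems] by (metis of_nat_mult)
  moreover have "real (c_tilde adj C (Suc i)) \<noteq> 0" using c_tilde_pos[OF Suc.prems] by simp
  ultimately have "real (card (clique_plus adj C x (Suc i))) =
      real (card (clique_plus adj C x i)) * real (b_num adj (Suc i)) / real (c_tilde adj C (Suc i))"
    by (simp add: field_simps)
  then show ?case using Suc by simp
qed

lemma clique_minus_nonempty:
  assumes "i < gdiameter adj"
  shows "clique_minus adj C x i \<noteq> {}"
  using assms
proof (induction i)
  case 0
  then show ?case by (simp add: clique_minus_0)
next
  case (Suc i)
  then have "card (clique_minus adj C x i) * b_tilde adj C i > 0"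
    using b_tilde_pos[OF Suc.prems] by (simp add: card_gt_0_iff)
  then show ?case using card_minus_step[OF Suc.prems] by auto
qed

end


section \<open>Characteristic vectors\<close>

lemma hat_nth: "hat Y $ y = (if y \<in> Y then 1 else 0)"
  unfolding hat_def by (simp add: axis_def eq_commute)

lemma hinner_hat: "hinner (hat Y) (hat Z) = of_nat (card (Y \<inter> Z))"
proof -
  have "hinner (hat Y) (hat Z) = (\<Sum>y\<in>UNIV. if y \<in> Y \<inter> Z then 1 else 0)"
    unfolding hinner_def by (intro sum.cong) (auto simp: hat_nth)
  then show ?thesis by (simp add: sum.If_cases Int_def)
qed

lemma norm_hat: "(norm (hat Y))\<^sup>2 = real (card Y)"
  using hinner_self[of "hat Y"] hinner_hat[of Y Y] by (metis Int_absorb of_real_eq_iff of_real_of_nat_eq)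

lemma orthogonal_basis_hat:
  assumes fin: "finite I" and ne: "\<And>i. i \<in> I \<Longrightarrow> Y i \<noteq> {}"
    and disj: "\<And>i j. i \<in> I \<Longrightarrow> j \<in> I \<Longrightarrow> i \<noteq> j \<Longrightarrow> Y i \<inter> Y j = {}"
  shows "orthogonal_basis I (\<lambda>i. hat (Y i)) (vec.span ((\<lambda>i. hat (Y i)) ` I))"
proof -
  have inj: "inj_on (\<lambda>i. hat (Y i)) I"
  proof (rule inj_onI, rule ccontr)
    fix i j assume ij: "i \<in> I" "j \<in> I" "hat (Y i) = hat (Y j)" "i \<noteq> j"
    obtain y where y: "y \<in> Y i" using ne ij(1) by blast
    then have "y \<notin> Y j" using disj ij by blast
    then show False using arg_cong[OF ij(3), of "\<lambda>v. v $ y"] y by (simp add: hat_nth)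
  qed
  have "vec.independent ((\<lambda>i. hat (Y i)) ` I)"
  proof
    assume "vec.dependent ((\<lambda>i. hat (Y i)) ` I)"
    then obtain u i where i: "i \<in> I" "u (hat (Y i)) \<noteq> 0"
      and u: "(\<Sum>v\<in>(\<lambda>i. hat (Y i)) ` I. u v *s v) = 0"
      using vec.dependent_finite[of "(\<lambda>i. hat (Y i)) ` I"] fin by auto
    obtain y where y: "y \<in> Y i" using ne i(1) by blast
    have "0 = (\<Sum>j\<in>I. u (hat (Y j)) *s hat (Y j)) $ y"
      using u by (simp add: sum.reindex[OF inj])
    also have "\<dots> = (\<Sum>j\<in>I. if j = i then u (hat (Y i)) else 0)"
      unfolding sum_component using y disj[OF i(1)]
      by (intro sum.cong refl) (auto simp: hat_nth)
    also have "\<dots> = u (hat (Y i))" using fin i(1) by simp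
    finally show False using i(2) by simp
  qed
  moreover have "hinner (hat (Y i)) (hat (Y j)) = 0" if "i \<in> I" "j \<in> I" "i \<noteq> j" for i j
    using disj[OF that] by (simp add: hinner_hat)
  ultimately show ?thesis unfolding orthogonal_basis_def using inj by auto
qed

section \<open>The primitive idempotents and the least eigenvalue\<close>

context drg
begin

lemma primitive_idempotent_entries:
  assumes E: "primitive_idempotents_of adj d E"
    and A: "adj_matrix adj = (\<Sum>i=0..d. mscale (complex_of_real (\<theta> i)) (E i))" and "i \<le> d"
  obtains f where "f 0 > 0" "\<And>y z. E i $ y $ z = complex_of_real (f (gdist adj y z))"
    "drg_idempotent adj f (\<theta> i)"
proof -
  have "primitive_idempotent (bose_mesner adj) (E i)"
    using E \<open>i \<le> d\<close> unfolding primitive_idempotents_of_def bij_betw_def by auto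
  then have p: "E i \<in> bose_mesner adj" "E i \<noteq> 0" "E i ** E i = E i"
    unfolding primitive_idempotent_def by auto
  have AE: "adj_matrix adj ** E i = mscale (complex_of_real (\<theta> i)) (E i)"
    using adj_matrix_mult_idempotent[OF E A \<open>i \<le> d\<close>] .
  obtain f where f: "f 0 > 0" "\<And>y z. E i $ y $ z = complex_of_real (f (gdist adj y z))"
    using idempotent_real_entries[OF p AE] by blast
  have "drg_idempotent adj f (\<theta> i)"
  proof unfold_locales
    show "f 0 > 0" by (rule f(1))
    fix y z
    have "complex_of_real (\<Sum>w\<in>{w. adj y w}. f (gdist adj w z)) = complex_of_real (\<theta> i * f (gdist adj y z))"
      using arg_cong[OF AE, of "\<lambda>N. N $ y $ z"] by (simp add: adj_matrix_mult_entry mscale_def f(2))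
    then show "(\<Sum>w\<in>{w. adj y w}. f (gdist adj w z)) = \<theta> i * f (gdist adj y z)"
      by (simp only: of_real_eq_iff)
    have "complex_of_real (\<Sum>w\<in>UNIV. f (gdist adj y w) * f (gdist adj w z)) =
        complex_of_real (f (gdist adj y z))"
      using arg_cong[OF p(3), of "\<lambda>N. N $ y $ z"] by (simp add: matrix_matrix_mult_def f(2))
    then show "(\<Sum>w\<in>UNIV. f (gdist adj y w) * f (gdist adj w z)) = f (gdist adj y z)"
      by (simp only: of_real_eq_iff)
  qed
  with f show thesis using that by blast
qed

text \<open>
  The diagonal of the adjacency matrix vanishes, whereas the primitive idempotents have
  positive diagonal entries.
\<close>

lemma least_eigenvalue_neg:
  assumes E: "primitive_idempotents_of adj d E"
    and A: "adj_matrix adj = (\<Sum>i=0..d. mscale (complex_of_real (\<theta> i)) (E i))"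
    and dec: "\<forall>i<d. \<theta> i > \<theta> (i + 1)" and d: "0 < d"
  shows "\<theta> d < 0"
proof (rule ccontr)
  assume neg: "\<not> \<theta> d < 0"
  define y :: 'a where "y = undefined"
  have "\<exists>r>0. E i $ y $ y = complex_of_real r" if "i \<le> d" for i
    using primitive_idempotent_entries[OF E A that] by (metis gdist_refl)
  then have "\<forall>i\<in>{0..d}. \<exists>r>0. E i $ y $ y = complex_of_real r" by simp
  then obtain r where r: "\<forall>i\<in>{0..d}. r i > 0 \<and> E i $ y $ y = complex_of_real (r i)" by metis
  have ge: "\<theta> i \<ge> \<theta> d" if "i \<le> d" for i
    using that by (induction rule: inc_induct) (use dec in \<open>force+\<close>)
  have "complex_of_real (\<Sum>i=0..d. \<theta> i * r i) = adj_matrix adj $ y $ y"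
    unfolding A using r by (simp add: mscale_def)
  also have "\<dots> = 0" by (simp add: adj_matrix_def adj_irrefl)
  finally have zero: "(\<Sum>i=0..d. \<theta> i * r i) = 0" by (simp only: of_real_eq_0_iff)
  have "\<theta> 0 > 0" using dec d ge[of 1] neg by force
  then have first: "0 < \<theta> 0 * r 0" using r by simp
  have nonneg: "0 \<le> \<theta> i * r i" if "i \<in> {0..d}" for i
  proof (rule mult_nonneg_nonneg)
    show "0 \<le> \<theta> i" using ge[of i] that neg by simp
    show "0 \<le> r i" using r that by (simp add: less_imp_le)
  qed
  have "(\<Sum>i=0..d. \<theta> i * r i) > 0"
    by (rule sum_pos2[where i = 0]) (use first nonneg in auto)
  with zero show False by simp
qed

end

theorem lemma5p7:
  fixes adj :: "'a::finite \<Rightarrow> 'a \<Rightarrow> bool" and d :: nat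
    and E :: "nat \<Rightarrow> complex ^ 'a ^ 'a" and \<theta> :: "nat \<Rightarrow> real" and \<theta>s :: "nat \<Rightarrow> complex"
    and C :: "'a set" and x :: 'a
    and q h hs s ss r\<^sub>1 r\<^sub>2 :: complex and \<phi>\<^sub>1 \<phi>\<^sub>2 :: "nat \<Rightarrow> complex"
  assumes "simple_graph adj" and "connected_graph adj"
    and "d = gdiameter adj" and "3 \<le> d"
    and "distance_regular adj"
    and "primitive_idempotents_of adj d E"
    and "adj_matrix adj = (\<Sum>i=0..d. mscale (complex_of_real (\<theta> i)) (E i))"
    and "Q_polynomial d E"
    and "\<forall>i<d. \<theta> i > \<theta> (i + 1)"
    and "Delsarte_clique adj (\<theta> d) C" and "x \<in> C"
    and "dual_adj_matrix E x = (\<Sum>i=0..d. mscale (\<theta>s i) (dual_idempotent adj x i))"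
    and "Leonard_system (primary_module adj x) d (adj_matrix adj) (dual_adj_matrix E x)
           E (dual_idempotent adj x)"
    and "parameter_array (primary_module adj x) d (adj_matrix adj) (dual_adj_matrix E x)
           E (dual_idempotent adj x) (\<lambda>i. complex_of_real (\<theta> i)) \<theta>s \<phi>\<^sub>1 \<phi>\<^sub>2"
    and "q_Racah q d h hs s ss r\<^sub>1 r\<^sub>2 (\<lambda>i. complex_of_real (\<theta> i)) \<theta>s \<phi>\<^sub>1 \<phi>\<^sub>2"
  shows "orthogonal_basis ({0..<d} <+> {0..<d})
           (case_sum (\<lambda>i. hat (clique_minus adj C x i)) (\<lambda>i. hat (clique_plus adj C x i)))
           (vec.span ((\<lambda>i. hat (clique_minus adj C x i)) ` {0..<d} \<union>
                      (\<lambda>i. hat (clique_plus adj C x i)) ` {0..<d}))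
       \<and> (\<forall>i<d.
           (norm (hat (clique_minus adj C x i)))\<^sup>2 =
             (\<Prod>j=0..<i. real (b_tilde adj C j)) / (\<Prod>j=1..i. real (c_num adj j)) \<and>
           (norm (hat (clique_plus adj C x i)))\<^sup>2 =
             (\<Prod>j=1..i. real (b_num adj j)) / (\<Prod>j=1..i. real (c_tilde adj C j)) *
             (real (card C) - 1))"
proof -
  interpret drg adj
    by unfold_locales (fact assms)+
  obtain f where idem: "drg_idempotent adj f (\<theta> d)"
    using primitive_idempotent_entries[OF assms(6,7) order_refl] by metis
  interpret drg_idempotent adj f "\<theta> d" by (rule idem)
  have neg: "\<theta> d < 0" using least_eigenvalue_neg[OF assms(6,7,9)] assms(4) by simp
  interpret clique_vertex adj f "\<theta> d" C x
  proof unfold_locales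
    show "C \<noteq> {}" "\<And>y z. y \<in> C \<Longrightarrow> z \<in> C \<Longrightarrow> y \<noteq> z \<Longrightarrow> adj y z"
      using assms(10) unfolding Delsarte_clique_def by auto
    show "(\<Sum>w\<in>C. f (gdist adj y w)) = 0" for y
      using Delsarte_clique_kernel[OF assms(10)] neg by simp
  qed (fact assms)
  let ?I = "{0..<d} <+> {0..<d}"
  let ?Y = "case_sum (clique_minus adj C x) (clique_plus adj C x)"
  have hat: "(\<lambda>i. hat (?Y i)) =
      case_sum (\<lambda>i. hat (clique_minus adj C x i)) (\<lambda>i. hat (clique_plus adj C x i))"
    by (rule ext) (auto split: sum.split)
  have "orthogonal_basis ?I (\<lambda>i. hat (?Y i)) (vec.span ((\<lambda>i. hat (?Y i)) ` ?I))"
    by (rule orthogonal_basis_hat)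
      (auto simp: in_minus_iff in_plus_iff clique_cell_def clique_minus_nonempty
        clique_plus_nonempty assms(3))
  moreover have "(\<lambda>i. hat (?Y i)) ` ?I = (\<lambda>i. hat (clique_minus adj C x i)) ` {0..<d} \<union>
      (\<lambda>i. hat (clique_plus adj C x i)) ` {0..<d}"
    by (auto simp: Plus_def image_Un image_image)
  ultimately show ?thesis
    using card_minus card_plus by (simp add: norm_hat assms(3)[symmetric] hat)
qed

end
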